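(* Let $F:\Omega\to\mathbb{R}$ be a random variable such that $|F_k^+-F_k^-|\le K$ for all $k\in\mathbb{N}$, for some $K\ge0$, and $\|DF\|_{L^\infty(\Omega,\ell^2(\mathbb{N}))}<\infty$. Then for all $x\ge0$, $$\mathbb{P}(F-E[F]\ge x)\le\exp\left(-\frac{\|DF\|^2_{L^\infty(\Omega,\ell^2(\mathbb{N}))}}{K^2}\,g\left(\frac{xK}{\|DF\|^2_{L^\infty(\Omega,\ell^2(\mathbb{N}))}}\right)\right)\le\exp\left(-\frac{x}{2K}\log\left(1+\frac{xK}{\|DF\|^2_{L^\infty(\Omega,\ell^2(\mathbb{N}))}}\right)\right),$$ with $g(u)=(1+u)\log(1+u)-u$, $u\ge0$.
   Context: $\mathbb{N}=\{0,1,2,\ldots\}$. Let $(p_k)_{k\in\mathbb{N}}$ be a deterministic sequence in $(0,1)$ and $q_k=1-p_k$. Let $\Omega=\{-1,1\}^{\mathbb{N}}$ with its product $\sigma$-algebra, let $X_k:\Omega\to\{-1,1\}$ be the canonical projections, and let $\mathbb{P}$ be the product probability measure under which the $X_k$ are independent with $\mathbb{P}(X_k=1)=p_k$, $\mathbb{P}(X_k=-1)=q_k$. For $F:\Omega\to\mathbb{R}$ let $F_k^\pm(\omega)=F(\omega_\pm^k)$, where $\omega_\pm^k$ is $\omega$ with its $k$-th coordinate replaced by $\pm1$, let $D_kF=\sqrt{p_kq_k}\,(F_k^+-F_k^-)$ and $DF=(D_kF)_{k\in\mathbb{N}}$. $\|DF\|_{L^\infty(\Omega,\ell^2(\mathbb{N}))}$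 is the essential supremum of $\omega\mapsto\big(\sum_{k=0}^\infty|D_kF(\omega)|^2\big)^{1/2}$. When $K=0$ or $\|DF\|_{L^\infty(\Omega,\ell^2(\mathbb{N}))}=0$ (so that $F$ is a.s. constant), the bounds are understood as the corresponding limits, i.e. as $0$ for $x>0$ and $1$ for $x=0$. *)

theory Defs
  imports "HOL-Probability.Probability"
begin

definition bernoulli_space :: "(nat \<Rightarrow> real) \<Rightarrow> (nat \<Rightarrow> int) measure" where
  "bernoulli_space p =
     (\<Pi>\<^sub>M k\<in>UNIV. point_measure {-1, 1} (\<lambda>s. ennreal (if s = 1 then p k else 1 - p k)))"

definition bernoulli_grad ::
  "(nat \<Rightarrow> real) \<Rightarrow> nat \<Rightarrow> ((nat \<Rightarrow> int) \<Rightarrow> real) \<Rightarrow> (nat \<Rightarrow> int) \<Rightarrow> real" where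
  "bernoulli_grad p k F w = sqrt (p k * (1 - p k)) * (F (w(k := 1)) - F (w(k := -1)))"

text \<open>
  The norm in \<open>\<ell>\<^sup>2(\<nat>)\<close>, with value \<open>\<infinity>\<close> on sequences that are not
  square-summable.
\<close>

definition ell2_norm :: "(nat \<Rightarrow> real) \<Rightarrow> ennreal" where
  "ell2_norm a =
     (if summable (\<lambda>k. \<bar>a k\<bar>\<^sup>2) then ennreal (sqrt (\<Sum>k. \<bar>a k\<bar>\<^sup>2)) else \<infinity>)"

definition grad_Linf_norm :: "(nat \<Rightarrow> real) \<Rightarrow> ((nat \<Rightarrow> int) \<Rightarrow> real) \<Rightarrow> ennreal" where
  "grad_Linf_norm p F =
     esssup (bernoulli_space p) (\<lambda>w. ell2_norm (\<lambda>k. bernoulli_grad p k F w))"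

definition bennett_g :: "real \<Rightarrow> real" where
  "bennett_g u = (1 + u) * ln (1 + u) - u"

text \<open>
  The two deviation bounds, as functions of \<open>N = \<parallel>DF\<parallel>\<close>, \<open>K\<close> and \<open>x\<close>.  In the degenerate
  cases \<open>K = 0\<close> and \<open>N = 0\<close>, division by zero would give the value \<open>1\<close> also for
  \<open>x > 0\<close>, so the limits are put in explicitly.
\<close>

definition bennett_bound :: "real \<Rightarrow> real \<Rightarrow> real \<Rightarrow> real" where
  "bennett_bound N K x =
     (if K = 0 \<or> N = 0 then (if x = 0 then 1 else 0)
      else exp (- (N\<^sup>2 / K\<^sup>2) * bennett_g (x * K / N\<^sup>2)))"

definition log_bound :: "real \<Rightarrow> real \<Rightarrow> real \<Rightarrow> real" where
  "log_bound N K x =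
     (if K = 0 \<or> N = 0 then (if x = 0 then 1 else 0)
      else exp (- (x / (2 * K)) * ln (1 + x * K / N\<^sup>2)))"

end

theory Submission
  imports Defs
begin

text \<open>
  The proof is the entropy method. For a function of one biased coin with values \<open>a\<close> and \<open>b\<close>, the
  entropy of its exponential is at most \<open>p q \<phi>(\<bar>a - b\<bar>)\<close> times the mean of the exponential, where
  \<open>\<phi> u = u e\<^sup>u - e\<^sup>u + 1\<close>. Since \<open>\<phi> u / u\<^sup>2\<close> increases, tensorization bounds the entropy of \<open>exp (t F)\<close>
  by \<open>\<phi>(t K) / K\<^sup>2 \<parallel>DF\<parallel>\<^sup>2\<close> times its mean, and Herbst's argument turns this into
  \<open>E exp (t (F - E F)) \<le> exp (\<parallel>DF\<parallel>\<^sup>2 / K\<^sup>2 (e\<^bsup>tK\<^esup> - 1 - t K))\<close>. Chernoff's bound with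
  \<open>t = ln (1 + x K / \<parallel>DF\<parallel>\<^sup>2) / K\<close> gives the first inequality; the second one is
  \<open>g u \<ge> u / 2 ln (1 + u)\<close>.

  The exponential bound is purely algebraic when only the first \<open>n\<close> coordinates are averaged out,
  and these averages tend to \<open>E F\<close> in \<open>L\<^sup>1\<close> because the tail \<open>\<sigma>\<close>-algebra is trivial. Integrability of
  \<open>F\<close> is obtained from its truncations: they concentrate uniformly around their means, and these means
  are bounded since \<open>F\<close> is bounded on a set of probability at least one half.
\<close>

section \<open>One-variable inequalities\<close>

lemma ln_ge_two_mult_div:
  fixes u :: real
  assumes "0 \<le> u"
  shows "2 * u / (2 + u) \<le> ln (1 + u)"
proof -
  let ?f = "\<lambda>u::real. ln (1 + u) - 2 * u / (2 + u)"
  have "?f 0 \<le> ?f u"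
  proof (rule DERIV_nonneg_imp_nondecreasing[OF assms])
    fix x :: real assume x: "0 \<le> x" "x \<le> u"
    have "(?f has_real_derivative 1 / (1 + x) - (2 * (2 + x) - 2 * x) / ((2 + x) * (2 + x))) (at x)"
      using x by (auto intro!: derivative_eq_intros)
    also have "1 / (1 + x) - (2 * (2 + x) - 2 * x) / ((2 + x) * (2 + x)) = x\<^sup>2 / ((1 + x) * (2 + x)\<^sup>2)"
      using x by (simp add: divide_simps power2_eq_square) algebra
    finally show "\<exists>y. (?f has_real_derivative y) (at x) \<and> 0 \<le> y"
      using x by (intro exI[of _ "x\<^sup>2 / ((1 + x) * (2 + x)\<^sup>2)"]) auto
  qed
  then show ?thesis by simp
qed

text \<open>Twice the difference of the two sides is \<open>(2 + u) * ln (1 + u) - 2 * u\<close>, so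
  this is \<open>ln_ge_two_mult_div\<close> multiplied by \<open>2 + u\<close>.\<close>

lemma bennett_g_ge:
  assumes "0 \<le> u"
  shows "u / 2 * ln (1 + u) \<le> bennett_g u"
proof -
  have "2 * u \<le> (2 + u) * ln (1 + u)"
    using ln_ge_two_mult_div[OF assms] assms by (simp add: field_simps)
  then show ?thesis
    unfolding bennett_g_def by (simp add: field_simps)
qed

lemma bennett_bound_le_log_bound:
  assumes "0 \<le> K" "0 \<le> x"
  shows "bennett_bound N K x \<le> log_bound N K x"
proof (cases "K = 0 \<or> N = 0")
  case False
  define u where "u = x * K / N\<^sup>2"
  have "0 \<le> u" unfolding u_def using assms by simp
  then have "N\<^sup>2 / K\<^sup>2 * (u / 2 * ln (1 + u)) \<le> N\<^sup>2 / K\<^sup>2 * bennett_g u"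
    by (intro mult_left_mono bennett_g_ge) auto
  moreover have "N\<^sup>2 / K\<^sup>2 * (u / 2 * ln (1 + u)) = x / (2 * K) * ln (1 + u)"
    using False by (simp add: u_def power2_eq_square)
  ultimately show ?thesis
    using False by (simp add: bennett_bound_def log_bound_def u_def)
qed (auto simp: bennett_bound_def log_bound_def)

section \<open>Entropy of a function of one biased coin\<close>

definition entropy_profile :: "real \<Rightarrow> real" where
  "entropy_profile u = u * exp u - exp u + 1"

lemma entropy_profile_deriv:
  "(entropy_profile has_real_derivative u * exp u) (at u)"
  unfolding entropy_profile_def by (auto intro!: derivative_eq_intros)

lemma entropy_profile_0 [simp]: "entropy_profile 0 = 0"
  by (simp add: entropy_profile_def)

text \<open>Both sides vanish at \<open>u = 0\<close>, and their derivatives in \<open>u\<close> are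
  \<open>l\<^sup>2 * u * exp (l * u)\<close> and \<open>l\<^sup>2 * u * exp u\<close>. This is the
  monotonicity of \<open>entropy_profile u / u\<^sup>2\<close>, freed of the division.\<close>

lemma entropy_profile_scale:
  assumes "0 \<le> l" "l \<le> 1" "0 \<le> u"
  shows "entropy_profile (l * u) \<le> l\<^sup>2 * entropy_profile u"
proof -
  let ?f = "\<lambda>u. l\<^sup>2 * entropy_profile u - entropy_profile (l * u)"
  have "?f 0 \<le> ?f u"
  proof (rule DERIV_nonneg_imp_nondecreasing[OF assms(3)])
    fix x :: real assume x: "0 \<le> x" "x \<le> u"
    have "(?f has_real_derivative l\<^sup>2 * (x * exp x) - (l * x) * exp (l * x) * l) (at x)"
      by (auto intro!: derivative_eq_intros DERIV_chain2[OF entropy_profile_deriv])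
    moreover have "l * x \<le> x" using assms x by (simp add: mult_left_le_one_le)
    then have "l\<^sup>2 * x * exp (l * x) \<le> l\<^sup>2 * x * exp x"
      using assms x by (intro mult_left_mono) auto
    ultimately show "\<exists>y. (?f has_real_derivative y) (at x) \<and> 0 \<le> y"
      by (intro exI conjI) (auto simp: power2_eq_square algebra_simps)
  qed
  then show ?thesis by simp
qed

lemma entropy_profile_nonneg: "0 \<le> u \<Longrightarrow> 0 \<le> entropy_profile u"
  using entropy_profile_scale[of 0 u] entropy_profile_scale[of "1 / 2" u]
    DERIV_nonneg_imp_nondecreasing[of 0 u entropy_profile] entropy_profile_deriv
  by fastforce

text \<open>Trades the uniform bound \<open>K\<close> for the square of the increment, so that the
  contributions of all coordinates add up to the squared gradient norm.\<close>

lemma entropy_profile_quadratic: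
  assumes "0 < K" "0 \<le> t" "0 \<le> d" "d \<le> K"
  shows "entropy_profile (t * d) \<le> d\<^sup>2 / K\<^sup>2 * entropy_profile (t * K)"
  using entropy_profile_scale[of "d / K" "t * K"] assms by (simp add: power_divide field_simps)

text \<open>Gibbs' variational principle: the entropy of a positive function is the largest mean of
  the function times the logarithm of a density, and \<open>u\<close>, \<open>v\<close> are the
  values of a competing density.\<close>

lemma two_point_gibbs:
  fixes p a b u v :: real
  assumes p: "0 < p" "p < 1" and "0 < a" "0 < b" "0 < u" "0 < v"
    and norm: "p * u + (1 - p) * v = 1"
  shows "p * (a * ln u) + (1 - p) * (b * ln v)
    \<le> p * (a * ln a) + (1 - p) * (b * ln b) - (p * a + (1 - p) * b) * ln (p * a + (1 - p) * b)"
proof -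
  define m where "m = p * a + (1 - p) * b"
  have m: "0 < m" unfolding m_def using assms by (simp add: add_pos_pos)
  \<comment> \<open>This is \<open>ln y \<le> y - 1\<close> at \<open>y = z * m / c\<close>; the
    right-hand sides average to \<open>0\<close> because the density has mean
    \<open>1\<close>.\<close>
  have *: "c * (ln z - (ln c - ln m)) \<le> z * m - c" if "0 < c" "0 < z" for c z :: real
  proof -
    have "ln (z * m / c) \<le> z * m / c - 1"
      using that m by (intro ln_le_minus_one) auto
    then have "c * ln (z * m / c) \<le> c * (z * m / c - 1)"
      using that by (intro mult_left_mono) auto
    then show ?thesis using that m by (simp add: ln_mult ln_div algebra_simps)
  qed
  have "p * (a * (ln u - (ln a - ln m))) + (1 - p) * (b * (ln v - (ln b - ln m)))
      \<le> p * (u * m - a) + (1 - p) * (v * m - b)"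
    using assms by (intro add_mono mult_left_mono *) auto
  also have "\<dots> = (p * u + (1 - p) * v) * m - m"
    by (simp add: m_def algebra_simps)
  also have "\<dots> = 0" by (simp add: norm)
  finally show ?thesis
    unfolding m_def[symmetric] by (simp add: algebra_simps m_def)
qed

text \<open>Dividing by \<open>m h\<close> leaves a function that vanishes at \<open>0\<close> and
  decreases: its derivative is \<open>p * (1 - p) * x * exp x * (1 / (m x)\<^sup>2 - 1)\<close>, and
  \<open>m x \<ge> 1\<close>.\<close>

lemma two_point_entropy_aux:
  fixes p h :: real
  assumes p: "0 < p" "p < 1" and h: "0 \<le> h"
  defines "m \<equiv> \<lambda>h. p * exp h + (1 - p)"
  shows "p * (h * exp h) - m h * ln (m h) \<le> p * (1 - p) * entropy_profile h * m h"
proof -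
  have m: "0 < m x" for x unfolding m_def using p by (simp add: add_pos_pos)
  have dm: "(m has_real_derivative p * exp x) (at x)" for x
    unfolding m_def by (auto intro!: derivative_eq_intros)
  let ?R = "\<lambda>x. p * (x * exp x) / m x - ln (m x) - p * (1 - p) * entropy_profile x"
  have "?R h \<le> ?R 0"
  proof (rule DERIV_nonpos_imp_nonincreasing[OF h])
    fix x assume x: "0 \<le> x" "x \<le> h"
    let ?D = "p * (1 - p) * x * exp x * (1 / (m x)\<^sup>2 - 1)"
    have mx: "m x \<noteq> 0" using m[of x] by simp
    have "(?R has_real_derivative
        (p * (exp x + x * exp x) * m x - p * (x * exp x) * (p * exp x)) / (m x * m x)
          - p * exp x / m x - p * (1 - p) * (x * exp x)) (at x)"
      using m[of x] by (auto intro!: derivative_eq_intros dm entropy_profile_deriv)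
    also have "(p * (exp x + x * exp x) * m x - p * (x * exp x) * (p * exp x)) / (m x * m x)
          - p * exp x / m x - p * (1 - p) * (x * exp x)
        = p * x * exp x * (m x - p * exp x) / (m x)\<^sup>2 - p * (1 - p) * (x * exp x)"
      using mx by (simp add: divide_simps power2_eq_square) algebra
    also have "m x - p * exp x = 1 - p" by (simp add: m_def)
    also have "p * x * exp x * (1 - p) / (m x)\<^sup>2 - p * (1 - p) * (x * exp x) = ?D"
      by (simp add: algebra_simps add_divide_distrib[symmetric])
    finally have "(?R has_real_derivative ?D) (at x)" .
    moreover have "1 \<le> m x"
    proof -
      have "p * 1 \<le> p * exp x" using x p by (intro mult_left_mono) auto
      then show ?thesis by (simp add: m_def)
    qed
    then have "1 / (m x)\<^sup>2 \<le> 1" by (simp add: divide_le_eq_1)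
    then have "?D \<le> 0" using p x by (intro mult_nonneg_nonpos) auto
    ultimately show "\<exists>y. (?R has_real_derivative y) (at x) \<and> y \<le> 0" by blast
  qed
  moreover have "?R 0 = 0" by (simp add: m_def)
  ultimately have "?R h * m h \<le> 0"
    using m[of h] by (simp add: mult_le_0_iff)
  moreover have "m h \<noteq> 0" using m[of h] by simp
  ultimately show ?thesis by (simp add: left_diff_distrib mult.commute[of _ "ln (m h)"])
qed

text \<open>Entropy is homogeneous of degree one, so the factor \<open>exp y\<close> can be taken
  out, which leaves the values \<open>exp h\<close> and \<open>1\<close>.\<close>

lemma two_point_entropy_ordered:
  fixes p x y :: real
  assumes p: "0 < p" "p < 1" and "y \<le> x"
  defines "m \<equiv> p * exp x + (1 - p) * exp y"
  shows "p * (exp x * x) + (1 - p) * (exp y * y) - m * ln m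
    \<le> p * (1 - p) * entropy_profile (x - y) * m"
proof -
  define h where "h = x - y"
  define k where "k = p * exp h + (1 - p)"
  have k: "0 < k" unfolding k_def using p by (simp add: add_pos_pos)
  have x: "x = h + y" by (simp add: h_def)
  have m: "m = exp y * k" by (simp add: m_def k_def x exp_add algebra_simps)
  have ln_m: "ln m = y + ln k" unfolding m using k by (simp add: ln_mult)
  have "p * (exp x * x) + (1 - p) * (exp y * y) - m * ln m
      = exp y * (p * (h * exp h) - k * ln k)"
    unfolding ln_m unfolding m unfolding x k_def by (simp add: exp_add algebra_simps)
  also have "\<dots> \<le> exp y * (p * (1 - p) * entropy_profile h * k)"
    using two_point_entropy_aux[OF p, of h] assms(3)
    by (intro mult_left_mono) (auto simp: k_def h_def)
  finally show ?thesis by (simp add: m h_def algebra_simps)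
qed

lemma two_point_entropy:
  fixes p x y :: real
  assumes p: "0 < p" "p < 1"
  defines "m \<equiv> p * exp x + (1 - p) * exp y"
  shows "p * (exp x * x) + (1 - p) * (exp y * y) - m * ln m
    \<le> p * (1 - p) * entropy_profile \<bar>x - y\<bar> * m"
proof (cases "y \<le> x")
  case True
  then show ?thesis using two_point_entropy_ordered[OF p True] by (simp add: m_def)
next
  case False
  then have "x \<le> y" by simp
  \<comment> \<open>Exchanging the two values replaces \<open>p\<close> by \<open>1 - p\<close> and
    leaves \<open>p * (1 - p)\<close> fixed.\<close>
  from two_point_entropy_ordered[of "1 - p", OF _ _ this] p False
  show ?thesis by (simp add: m_def algebra_simps)
qed

text \<open>Herbst's argument: \<open>u s / s\<close> decreases from its limit \<open>u' 0\<close> at \<open>0\<close>.\<close>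

lemma herbst:
  fixes u u' :: "real \<Rightarrow> real"
  assumes deriv: "\<And>s. (u has_real_derivative u' s) (at s)"
    and "u 0 = 0" and ineq: "\<And>s. 0 < s \<Longrightarrow> s * u' s \<le> u s" and t: "0 \<le> t"
  shows "u t \<le> t * u' 0"
proof (cases "t = 0")
  case False
  with t have "0 < t" by simp
  have dec: "u t / t \<le> u s / s" if s: "0 < s" "s \<le> t" for s
  proof (rule DERIV_nonpos_imp_nonincreasing[OF s(2)])
    fix x assume "s \<le> x" "x \<le> t"
    with s have x: "0 < x" by simp
    have "((\<lambda>s. u s / s) has_real_derivative (u' x * x - u x) / (x * x)) (at x)"
      using x by (auto intro!: derivative_eq_intros deriv)
    moreover have "(u' x * x - u x) / (x * x) \<le> 0"
      using ineq[OF x] x by (intro divide_nonpos_pos) (auto simp: mult.commute)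
    ultimately show "\<exists>y. ((\<lambda>s. u s / s) has_real_derivative y) (at x) \<and> y \<le> 0" by blast
  qed
  have "((\<lambda>s. u s / s) \<longlongrightarrow> u' 0) (at 0)"
    using deriv[of 0] \<open>u 0 = 0\<close> by (simp add: has_field_derivative_iff)
  then have "((\<lambda>s. u s / s) \<longlongrightarrow> u' 0) (at_right 0)"
    by (rule filterlim_mono) (auto simp: at_le)
  moreover have "\<forall>\<^sub>F s in at_right 0. u t / t \<le> u s / s"
    unfolding eventually_at_right[OF \<open>0 < t\<close>] using dec \<open>0 < t\<close> by (intro exI[of _ t]) auto
  ultimately have "u t / t \<le> u' 0"
    by (intro tendsto_lowerbound[of _ _ "at_right 0"]) auto
  then show ?thesis using \<open>0 < t\<close> by (simp add: field_simps)
qed (use assms in auto)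

section \<open>Averaging over finitely many coordinates\<close>

definition flip_average :: "(nat \<Rightarrow> real) \<Rightarrow> nat \<Rightarrow> ((nat \<Rightarrow> int) \<Rightarrow> real) \<Rightarrow> (nat \<Rightarrow> int) \<Rightarrow> real" where
  "flip_average p k f w = p k * f (w(k := 1)) + (1 - p k) * f (w(k := -1))"

text \<open>
  \<open>tail_average p n F\<close> is a version of the conditional expectation of \<open>F\<close> given
  \<open>X\<^sub>n, X\<^sub>n\<^sub>+\<^sub>1, \<dots>\<close>, defined pointwise and without any measurability or integrability.
\<close>

primrec tail_average :: "(nat \<Rightarrow> real) \<Rightarrow> nat \<Rightarrow> ((nat \<Rightarrow> int) \<Rightarrow> real) \<Rightarrow> (nat \<Rightarrow> int) \<Rightarrow> real" where
  "tail_average p 0 f = f"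
| "tail_average p (Suc n) f = flip_average p n (tail_average p n f)"

text \<open>An average at \<open>w\<close> evaluates a function only at points reached from
  \<open>w\<close> by finitely many flips. Pointwise bounds that hold on a predicate closed under
  flips therefore pass through the averages.\<close>

definition flip_closed :: "((nat \<Rightarrow> int) \<Rightarrow> bool) \<Rightarrow> bool" where
  "flip_closed G \<longleftrightarrow> (\<forall>w k. G w \<longrightarrow> G (w(k := 1)) \<and> G (w(k := -1)))"

lemma flip_closedD: "flip_closed G \<Longrightarrow> G w \<Longrightarrow> s \<in> {1, -1} \<Longrightarrow> G (w(k := s))"
  by (auto simp: flip_closed_def)

lemma flip_closed_True: "flip_closed (\<lambda>_. True)"
  by (simp add: flip_closed_def)

lemma tail_average_add:
  "tail_average p n (\<lambda>w. f w + g w) w = tail_average p n f w + tail_average p n g w"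
  by (induction n arbitrary: w) (simp_all add: flip_average_def algebra_simps)

lemma tail_average_cmult:
  "tail_average p n (\<lambda>w. c * f w) w = c * tail_average p n f w"
  by (induction n arbitrary: w) (simp_all add: flip_average_def algebra_simps)

lemma tail_average_diff:
  "tail_average p n (\<lambda>w. f w - g w) w = tail_average p n f w - tail_average p n g w"
  using tail_average_add[of p n f "\<lambda>w. - 1 * g w" w] tail_average_cmult[of p n "- 1" g w] by simp

lemma tail_average_const [simp]: "tail_average p n (\<lambda>_. c) w = c"
  by (induction n arbitrary: w) (simp_all add: flip_average_def algebra_simps)

lemma tail_average_sum:
  "tail_average p n (\<lambda>w. \<Sum>k\<in>I. f k w) w = (\<Sum>k\<in>I. tail_average p n (f k) w)"
  by (induction I rule: infinite_finite_induct) (simp_all add: tail_average_add)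

lemma tail_average_shift:
  "n \<le> k \<Longrightarrow> tail_average p n (\<lambda>w. f (w(k := s))) w = tail_average p n f (w(k := s))"
  by (induction n arbitrary: w) (simp_all add: flip_average_def fun_upd_twist)

lemma flip_average_tail_average:
  assumes "n \<le> k"
  shows "flip_average p k (tail_average p n f) w = tail_average p n (flip_average p k f) w"
  using assms unfolding flip_average_def[abs_def]
  by (simp add: tail_average_add tail_average_cmult tail_average_shift)

lemma flip_average_of_invariant:
  assumes "\<And>w s. f (w(k := s)) = f w"
  shows "flip_average p k f w = f w"
  unfolding flip_average_def assms by (simp add: algebra_simps)

text \<open>Tower property. For the last coordinate the two averages commute, and averaging twice
  over one coordinate changes nothing.\<close>

lemma tail_average_flip_average:
  "k < n \<Longrightarrow> tail_average p n (flip_average p k f) w = tail_average p n f w"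
proof (induction n arbitrary: w)
  case (Suc n)
  show ?case
  proof (cases "k = n")
    case True
    have "tail_average p n (flip_average p n f) = flip_average p n (tail_average p n f)"
      by (rule ext) (simp add: flip_average_tail_average)
    moreover have "flip_average p n (flip_average p n g) w = flip_average p n g w" for g w
      by (rule flip_average_of_invariant) (simp add: flip_average_def)
    ultimately show ?thesis by (simp add: True)
  next
    case False
    with Suc have "tail_average p n (flip_average p k f) = tail_average p n f"
      by (intro ext) simp
    then show ?thesis by simp
  qed
qed simp

lemma tail_average_has_derivative:
  assumes "\<And>w. ((\<lambda>t. f t w) has_real_derivative f' w) (at t)"
  shows "((\<lambda>t. tail_average p n (f t) w) has_real_derivative tail_average p n f' w) (at t)"
  by (induction n arbitrary: w)
    (auto simp: flip_average_def intro!: assms derivative_eq_intros)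

text \<open>For \<open>m \<le> n\<close> the last premise is vacuous, so the average is constant on
  \<open>G\<close>; this is the case used for cylinder functions.\<close>

lemma tail_average_cong_cylinder:
  assumes G: "flip_closed G"
    and f: "\<And>v v'. G v \<Longrightarrow> G v' \<Longrightarrow> (\<forall>i<m. v i = v' i) \<Longrightarrow> f v = f v'"
  shows "G v \<Longrightarrow> G v' \<Longrightarrow> (\<forall>i<m. n \<le> i \<longrightarrow> v i = v' i) \<Longrightarrow>
    tail_average p n f v = tail_average p n f v'"
proof (induction n arbitrary: v v')
  case (Suc n)
  have "tail_average p n f (v(n := s)) = tail_average p n f (v'(n := s))" if "s \<in> {1, -1}" for s
    using Suc.prems that by (intro Suc.IH flip_closedD[OF G]) auto
  then show ?case by (simp add: flip_average_def)
qed (auto intro: f)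

lemma tail_average_mono:
  assumes p: "\<And>k. 0 < p k \<and> p k < 1" and G: "flip_closed G"
    and le: "\<And>v. G v \<Longrightarrow> f v \<le> g v" and "G w"
  shows "tail_average p n f w \<le> tail_average p n g w"
  using \<open>G w\<close>
proof (induction n arbitrary: w)
  case (Suc n)
  then show ?case
    using p[of n] by (auto simp: flip_average_def intro!: add_mono mult_left_mono flip_closedD[OF G])
qed (simp add: le)

lemma tail_average_pos:
  assumes p: "\<And>k. 0 < p k \<and> p k < 1" and "\<And>v. 0 < f v"
  shows "0 < tail_average p n f w"
proof (induction n arbitrary: w)
  case (Suc n)
  then show ?case
    using p[of n] by (auto simp: flip_average_def intro!: add_pos_pos mult_pos_pos)
qed (simp add: assms)

section \<open>Entropy and exponential moments of finite averages\<close>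

definition flip_entropy :: "(nat \<Rightarrow> real) \<Rightarrow> nat \<Rightarrow> ((nat \<Rightarrow> int) \<Rightarrow> real) \<Rightarrow> (nat \<Rightarrow> int) \<Rightarrow> real" where
  "flip_entropy p k f w =
     flip_average p k (\<lambda>w. f w * ln (f w)) w - flip_average p k f w * ln (flip_average p k f w)"

lemma flip_entropy_invariant: "flip_entropy p k f (w(k := s)) = flip_entropy p k f w"
  by (simp add: flip_entropy_def flip_average_def)

text \<open>Convexity of entropy. The density \<open>a / m\<close>, \<open>b / m\<close> attains
  equality in Gibbs' principle for the averaged function; the resulting expression is linear in
  \<open>f\<close>, so it passes under the average, where Gibbs' principle bounds it
  pointwise.\<close>

lemma flip_entropy_tail_average_le:
  assumes p: "\<And>k. 0 < p k \<and> p k < 1" and f: "\<And>v. 0 < f v"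
  shows "flip_entropy p n (tail_average p n f) w \<le> tail_average p n (flip_entropy p n f) w"
proof -
  define a where "a = tail_average p n f (w(n := 1))"
  define b where "b = tail_average p n f (w(n := -1))"
  define m where "m = p n * a + (1 - p n) * b"
  have pos: "0 < a" "0 < b" using tail_average_pos[OF p f] by (auto simp: a_def b_def)
  then have "0 < m" using p[of n] by (simp add: m_def add_pos_pos)
  have norm: "p n * (a / m) + (1 - p n) * (b / m) = 1"
    using \<open>0 < m\<close> by (simp add: m_def add_divide_distrib[symmetric])
  have "flip_entropy p n (tail_average p n f) w
      = p n * (a * ln a) + (1 - p n) * (b * ln b) - m * ln m"
    by (simp add: flip_entropy_def flip_average_def a_def b_def m_def)
  also have "\<dots> = p n * ln (a / m) * a + (1 - p n) * ln (b / m) * b"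
    using pos \<open>0 < m\<close> by (simp add: ln_div algebra_simps m_def)
  also have "\<dots> = tail_average p n
      (\<lambda>v. p n * ln (a / m) * f (v(n := 1)) + (1 - p n) * ln (b / m) * f (v(n := -1))) w"
    by (simp add: tail_average_add tail_average_cmult tail_average_shift a_def b_def)
  also have "\<dots> \<le> tail_average p n (flip_entropy p n f) w"
  proof (rule tail_average_mono[OF p flip_closed_True _ TrueI])
    fix v
    show "p n * ln (a / m) * f (v(n := 1)) + (1 - p n) * ln (b / m) * f (v(n := -1))
        \<le> flip_entropy p n f v"
      using two_point_gibbs[of "p n" "f (v(n := 1))" "f (v(n := -1))" "a / m" "b / m"]
        p[of n] f pos \<open>0 < m\<close> norm
      by (simp add: flip_entropy_def flip_average_def algebra_simps)
  qed
  finally show ?thesis .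
qed

text \<open>Averaging the bound for \<open>n\<close> over coordinate \<open>n\<close> leaves one new
  term, the entropy of \<open>tail_average p n f\<close> in that coordinate, and convexity controls
  it.\<close>

lemma entropy_tensorization:
  assumes p: "\<And>k. 0 < p k \<and> p k < 1" and f: "\<And>v. 0 < f v"
  shows "tail_average p n (\<lambda>w. f w * ln (f w)) w - tail_average p n f w * ln (tail_average p n f w)
    \<le> tail_average p n (\<lambda>w. \<Sum>k<n. flip_entropy p k f w) w"
proof (induction n arbitrary: w)
  case (Suc n)
  let ?T = "tail_average p n" and ?A = "flip_average p n"
  have "flip_average p n (?T (\<lambda>w. f w * ln (f w))) w
      \<le> ?A (\<lambda>w. ?T f w * ln (?T f w) + ?T (\<lambda>w. \<Sum>k<n. flip_entropy p k f w) w) w"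
    unfolding flip_average_def
    using Suc[of "w(n := 1)"] Suc[of "w(n := -1)"] p[of n]
    by (intro add_mono mult_left_mono) (auto simp: algebra_simps simp del: fun_upd_apply)
  also have "\<dots> = ?A (\<lambda>w. ?T f w * ln (?T f w)) w
      + tail_average p (Suc n) (\<lambda>w. \<Sum>k<n. flip_entropy p k f w) w"
    by (simp add: flip_average_def algebra_simps)
  also have "?A (\<lambda>w. ?T f w * ln (?T f w)) w
      = flip_entropy p n (?T f) w + ?A (?T f) w * ln (?A (?T f) w)"
    by (simp add: flip_entropy_def)
  also have "flip_entropy p n (?T f) w \<le> ?T (flip_entropy p n f) w"
    by (rule flip_entropy_tail_average_le[OF p f])
  \<comment> \<open>\<open>flip_entropy p n f\<close> does not depend on coordinate
    \<open>n\<close>, so averaging over that coordinate is free.\<close>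
  also have "?T (flip_entropy p n f) w = ?A (?T (flip_entropy p n f)) w"
    by (simp add: flip_average_def tail_average_shift[symmetric] flip_entropy_invariant algebra_simps)
  finally show ?case
    by (simp add: tail_average_add flip_average_def algebra_simps)
qed simp

text \<open>The squared gradient stays inside \<open>flip_average\<close> although it does not
  depend on coordinate \<open>k\<close>: in this form the tower property later removes the average
  over \<open>k\<close>.\<close>

lemma flip_entropy_exp_le:
  assumes p: "\<And>k. 0 < p k \<and> p k < 1" and "0 < K" "0 \<le> t"
    and diff: "\<bar>F (w(k := 1)) - F (w(k := -1))\<bar> \<le> K"
  shows "flip_entropy p k (\<lambda>w. exp (t * F w)) w
    \<le> entropy_profile (t * K) / K\<^sup>2
      * flip_average p k (\<lambda>v. (bernoulli_grad p k F v)\<^sup>2 * exp (t * F v)) w"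
proof -
  let ?a = "F (w(k := 1))" and ?b = "F (w(k := -1))"
  let ?m = "p k * exp (t * ?a) + (1 - p k) * exp (t * ?b)"
  have m: "0 < ?m" and pq: "0 \<le> p k * (1 - p k)" using p[of k] by (simp_all add: add_pos_pos)
  have "flip_entropy p k (\<lambda>w. exp (t * F w)) w
      \<le> p k * (1 - p k) * entropy_profile \<bar>t * ?a - t * ?b\<bar> * ?m"
    using two_point_entropy[of "p k" "t * ?a" "t * ?b"] p[of k]
    by (simp add: flip_entropy_def flip_average_def)
  also have "\<bar>t * ?a - t * ?b\<bar> = t * \<bar>?a - ?b\<bar>"
    using \<open>0 \<le> t\<close> by (simp add: right_diff_distrib[symmetric] abs_mult)
  also have "p k * (1 - p k) * entropy_profile (t * \<bar>?a - ?b\<bar>) * ?m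
      \<le> p k * (1 - p k) * (\<bar>?a - ?b\<bar>\<^sup>2 / K\<^sup>2 * entropy_profile (t * K)) * ?m"
    using pq m assms
    by (intro mult_right_mono mult_left_mono entropy_profile_quadratic) auto
  also have "\<dots> = entropy_profile (t * K) / K\<^sup>2
      * flip_average p k (\<lambda>v. (bernoulli_grad p k F v)\<^sup>2 * exp (t * F v)) w"
  proof -
    have "(bernoulli_grad p k F (w(k := s)))\<^sup>2 = p k * (1 - p k) * (?a - ?b)\<^sup>2" for s
      using pq by (simp add: bernoulli_grad_def power_mult_distrib)
    note D = this
    have "flip_average p k (\<lambda>v. (bernoulli_grad p k F v)\<^sup>2 * exp (t * F v)) w
        = p k * (1 - p k) * (?a - ?b)\<^sup>2 * ?m"
      unfolding flip_average_def D by (simp add: algebra_simps)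
    then show ?thesis by simp
  qed
  finally show ?thesis .
qed

text \<open>After tensorization the tower property absorbs the single-coordinate averages, so the
  squared gradients meet under one average and their sum is bounded pointwise by
  \<open>V\<close>.\<close>

lemma tail_average_exp_entropy_le:
  assumes p: "\<And>k. 0 < p k \<and> p k < 1" and "0 < K" "0 \<le> t" and G: "flip_closed G" and "G w"
    and diff: "\<And>k v. G v \<Longrightarrow> \<bar>F (v(k := 1)) - F (v(k := -1))\<bar> \<le> K"
    and grad: "\<And>v. G v \<Longrightarrow> (\<Sum>k<n. (bernoulli_grad p k F v)\<^sup>2) \<le> V"
  defines "L \<equiv> tail_average p n (\<lambda>w. exp (t * F w)) w"
  shows "tail_average p n (\<lambda>w. exp (t * F w) * (t * F w)) w - L * ln L
    \<le> V / K\<^sup>2 * entropy_profile (t * K) * L"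
proof -
  define c where "c = entropy_profile (t * K) / K\<^sup>2"
  let ?g = "\<lambda>k v. (bernoulli_grad p k F v)\<^sup>2 * exp (t * F v)"
  have c: "0 \<le> c"
    using assms by (simp add: c_def entropy_profile_nonneg)
  have "tail_average p n (\<lambda>w. exp (t * F w) * (t * F w)) w - L * ln L
      \<le> tail_average p n (\<lambda>w. \<Sum>k<n. flip_entropy p k (\<lambda>w. exp (t * F w)) w) w"
    using entropy_tensorization[OF p, where f = "\<lambda>w. exp (t * F w)" and n = n and w = w] by (simp add: L_def)
  also have "\<dots> \<le> tail_average p n (\<lambda>w. \<Sum>k<n. c * flip_average p k (?g k) w) w"
    unfolding c_def
    by (intro tail_average_mono[OF p G _ \<open>G w\<close>] sum_mono flip_entropy_exp_le p diff
        assms) 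
  also have "\<dots> = c * (\<Sum>k<n. tail_average p n (?g k) w)"
    by (simp add: tail_average_sum tail_average_cmult tail_average_flip_average sum_distrib_left)
  also have "\<dots> = c * tail_average p n (\<lambda>v. (\<Sum>k<n. (bernoulli_grad p k F v)\<^sup>2) * exp (t * F v)) w"
    by (simp add: tail_average_sum sum_distrib_right)
  also have "\<dots> \<le> c * tail_average p n (\<lambda>v. V * exp (t * F v)) w"
    using c by (intro mult_left_mono tail_average_mono[OF p G _ \<open>G w\<close>] mult_right_mono grad) auto
  also have "\<dots> = V / K\<^sup>2 * entropy_profile (t * K) * L"
    by (simp add: tail_average_cmult L_def c_def)
  finally show ?thesis .
qed

lemma tail_average_exp_le:
  assumes p: "\<And>k. 0 < p k \<and> p k < 1" and "0 < K" "0 \<le> t" and G: "flip_closed G" and "G w"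
    and diff: "\<And>k v. G v \<Longrightarrow> \<bar>F (v(k := 1)) - F (v(k := -1))\<bar> \<le> K"
    and grad: "\<And>v. G v \<Longrightarrow> (\<Sum>k<n. (bernoulli_grad p k F v)\<^sup>2) \<le> V"
  shows "tail_average p n (\<lambda>w. exp (t * F w)) w
    \<le> exp (V / K\<^sup>2 * (exp (t * K) - 1 - t * K)) * exp (t * tail_average p n F w)"
proof -
  define c where "c = V / K\<^sup>2"
  define L where "L = (\<lambda>s. tail_average p n (\<lambda>w. exp (s * F w)) w)"
  define L' where "L' = (\<lambda>s. tail_average p n (\<lambda>w. exp (s * F w) * F w) w)"
  have L: "0 < L s" for s unfolding L_def by (intro tail_average_pos p) simp
  have dL: "(L has_real_derivative L' s) (at s)" for s
    unfolding L_def L'_def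
    by (rule tail_average_has_derivative) (auto intro!: derivative_eq_intros)
  \<comment> \<open>With \<open>h s = c * (exp (s * K) - 1)\<close> one has
    \<open>s * h' s - h s = c * entropy_profile (s * K)\<close>, so the entropy bound is exactly the
    hypothesis of Herbst's argument for \<open>ln (L s) - h s\<close>. The derivative of
    \<open>h\<close> at \<open>0\<close> supplies the term \<open>t * K\<close> of the
    claim.\<close>
  have "ln (L t) - c * (exp (t * K) - 1)
      \<le> t * (L' 0 / L 0 - c * (exp (0 * K) * K))"
  proof (rule herbst[OF _ _ _ \<open>0 \<le> t\<close>])
    fix s :: real
    show "((\<lambda>s. ln (L s) - c * (exp (s * K) - 1)) has_real_derivative
        L' s / L s - c * (exp (s * K) * K)) (at s)"
      using L[of s] by (auto intro!: derivative_eq_intros dL)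
    assume s: "0 < s"
    have "tail_average p n (\<lambda>w. exp (s * F w) * (s * F w)) w = s * L' s"
      using tail_average_cmult[of p n s "\<lambda>w. exp (s * F w) * F w" w]
      by (simp add: L'_def algebra_simps)
    with tail_average_exp_entropy_le[OF p \<open>0 < K\<close> _ G \<open>G w\<close> diff grad, where t = s] s
    have "s * L' s - L s * ln (L s) \<le> c * entropy_profile (s * K) * L s"
      by (simp add: L_def c_def)
    then have "s * L' s / L s - ln (L s) \<le> c * entropy_profile (s * K)"
      using L[of s] by (simp add: field_simps)
    then show "s * (L' s / L s - c * (exp (s * K) * K))
        \<le> ln (L s) - c * (exp (s * K) - 1)"
      by (simp add: entropy_profile_def algebra_simps)
  qed (simp add: L_def)
  moreover have "L 0 = 1" "L' 0 = tail_average p n F w" by (simp_all add: L_def L'_def)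
  ultimately have "ln (L t) \<le> c * (exp (t * K) - 1 - t * K) + t * tail_average p n F w"
    by (simp add: algebra_simps)
  then have "exp (ln (L t)) \<le> exp (c * (exp (t * K) - 1 - t * K) + t * tail_average p n F w)"
    by simp
  then show ?thesis using L[of t] by (simp add: exp_add L_def c_def)
qed

section \<open>The Bernoulli space\<close>

locale bernoulli_sequence =
  fixes p :: "nat \<Rightarrow> real"
  assumes p: "\<And>k. 0 < p k \<and> p k < 1"
begin

abbreviation "P \<equiv> bernoulli_space p"

abbreviation "coin k \<equiv> point_measure {-1, 1 :: int} (\<lambda>s. ennreal (if s = 1 then p k else 1 - p k))"

lemma prob_space_coin: "prob_space (coin k)"
proof
  have "ennreal (p k) + ennreal (1 - p k) = 1"
    using p[of k] by (subst ennreal_plus[symmetric]) auto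
  then show "emeasure (coin k) (space (coin k)) = 1"
    by (simp add: emeasure_point_measure_finite space_point_measure add.commute)
qed

sublocale prob_space P
  unfolding bernoulli_space_def by (intro prob_space_PiM prob_space_coin)

lemma space_P: "w \<in> space P \<longleftrightarrow> (\<forall>k. w k \<in> {-1, 1})"
  by (auto simp: bernoulli_space_def space_PiM space_point_measure PiE_def Pi_iff extensional_def)

lemma flip_closed_space: "flip_closed (\<lambda>w. w \<in> space P)"
  by (auto simp: flip_closed_def space_P)

text \<open>Resampling one coordinate from an independent coin preserves the product measure;
  \<open>k\<close> already lies in \<open>UNIV\<close>, so the update overwrites a
  coordinate.\<close>

lemma coin_flip:
  shows measurable_coin_flip: "(\<lambda>(s, w). w(k := s)) \<in> coin k \<Otimes>\<^sub>M P \<rightarrow>\<^sub>M P"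
    and distr_coin_flip: "distr (coin k \<Otimes>\<^sub>M P) P (\<lambda>(s, w). w(k := s)) = P"
proof -
  have "(\<lambda>sw. (snd sw)(k := fst sw)) \<in> coin k \<Otimes>\<^sub>M P \<rightarrow>\<^sub>M PiM (insert k UNIV) coin"
    unfolding bernoulli_space_def
    by (rule measurable_fun_upd[where J = UNIV]) auto
  then show "(\<lambda>(s, w). w(k := s)) \<in> coin k \<Otimes>\<^sub>M P \<rightarrow>\<^sub>M P"
    by (simp add: bernoulli_space_def case_prod_beta)
  show "distr (coin k \<Otimes>\<^sub>M P) P (\<lambda>(s, w). w(k := s)) = P"
    using distr_pair_PiM_eq_PiM[of UNIV coin k, OF prob_space_coin prob_space_coin]
    by (simp add: bernoulli_space_def)
qed

lemma
  fixes f :: "(nat \<Rightarrow> int) \<Rightarrow> real"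
  assumes f: "integrable P f"
  shows integrable_flip_average: "integrable P (flip_average p k f)"
    and integral_flip_average: "(\<integral>w. flip_average p k f w \<partial>P) = (\<integral>w. f w \<partial>P)"
proof -
  interpret C: prob_space "coin k" by (rule prob_space_coin)
  interpret pair_sigma_finite "coin k" P ..
  have meas: "f \<in> borel_measurable P" using f by simp
  have int: "integrable (coin k \<Otimes>\<^sub>M P) (\<lambda>(s, w). f (w(k := s)))"
    using f integrable_distr_eq[OF measurable_coin_flip meas, of k]
    by (simp only: distr_coin_flip) (simp add: case_prod_unfold)
  have inner: "(\<integral>s. f (w(k := s)) \<partial>coin k) = flip_average p k f w" for w
    using p[of k] by (simp add: lebesgue_integral_point_measure_finite flip_average_def)
  show "integrable P (flip_average p k f)"
    using integrable_snd[OF int] by (simp add: inner[abs_def])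
  have "(\<integral>w. flip_average p k f w \<partial>P) = (\<integral>sw. (case sw of (s, w) \<Rightarrow> f (w(k := s))) \<partial>(coin k \<Otimes>\<^sub>M P))"
    using integral_snd[OF int] by (simp add: inner)
  also have "\<dots> = (\<integral>w. f w \<partial>distr (coin k \<Otimes>\<^sub>M P) P (\<lambda>(s, w). w(k := s)))"
    using integral_distr[OF measurable_coin_flip meas, of k] by (simp add: case_prod_beta)
  finally show "(\<integral>w. flip_average p k f w \<partial>P) = (\<integral>w. f w \<partial>P)"
    by (simp add: distr_coin_flip)
qed

text \<open>Both outcomes of a coin have positive weight, so the average of the indicator of a null
  set vanishes at \<open>w\<close> only if both flips of \<open>w\<close> avoid that set.\<close>

lemma AE_flip:
  assumes "AE w in P. Q w" and s: "s \<in> {1, -1}"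
  shows "AE w in P. Q (w(k := s))"
proof -
  from assms obtain N where N: "N \<in> null_sets P" "{w \<in> space P. \<not> Q w} \<subseteq> N"
    by (auto elim!: AE_E simp: null_sets_def)
  let ?i = "indicator N :: _ \<Rightarrow> real"
  have i: "integrable P ?i" and "(\<integral>w. ?i w \<partial>P) = 0"
    using N(1) by (auto simp: measure_def null_sets_def)
  then have "(\<integral>w. flip_average p k ?i w \<partial>P) = 0"
    using integral_flip_average[OF i] by simp
  moreover have "0 \<le> flip_average p k ?i w" for w
    using p[of k] by (auto simp: flip_average_def)
  ultimately have "AE w in P. flip_average p k ?i w = 0"
    using integral_nonneg_eq_0_iff_AE[OF integrable_flip_average[OF i]] by simp
  then show ?thesis
  proof (rule AE_mp, intro AE_I2 impI)
    fix w assume w: "w \<in> space P" and "flip_average p k ?i w = 0"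
    then have "w(k := s) \<notin> N"
      using p[of k] s unfolding flip_average_def
      by (auto simp: indicator_def add_nonneg_eq_0_iff split: if_splits)
    moreover have "w(k := s) \<in> space P" using flip_closedD[OF flip_closed_space w s] .
    ultimately show "Q (w(k := s))" using N(2) by auto
  qed
qed

text \<open>Finite sequences of flips are coded by lists over a countable type, so requiring
  \<open>Q\<close> after each of them still costs only a null set.\<close>

lemma AE_flip_closed:
  assumes "AE w in P. Q w"
  obtains G where "flip_closed G" "\<And>w. G w \<Longrightarrow> Q w" "AE w in P. G w"
proof -
  define upd :: "(nat \<times> bool) list \<Rightarrow> (nat \<Rightarrow> int) \<Rightarrow> nat \<Rightarrow> int"
    where "upd = foldr (\<lambda>(k, b) w. w(k := if b then 1 else -1))"
  define G where "G w \<longleftrightarrow> (\<forall>l. Q (upd l w))" for w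
  \<comment> \<open>\<open>foldr\<close> applies the last entry of the list first, so a preliminary
    flip of \<open>w\<close> is appended at the end.\<close>
  have upd_append: "upd l (w(k := if b then 1 else -1)) = upd (l @ [(k, b)]) w" for l w k b
    by (simp add: upd_def)
  have "flip_closed G"
    unfolding flip_closed_def G_def
    using upd_append[of _ _ _ True] upd_append[of _ _ _ False] by simp
  moreover have "Q w" if "G w" for w
    using that[unfolded G_def, rule_format, of "[]"] by (simp add: upd_def)
  moreover have "AE w in P. Q (upd l w)" for l
  proof (induction l rule: rev_induct)
    case Nil
    then show ?case using assms by (simp add: upd_def)
  next
    case (snoc kb l)
    obtain k b where [simp]: "kb = (k, b)" by (cases kb)
    show ?case
      using AE_flip[OF snoc.IH, of "if b then 1 else -1" k]
      unfolding upd_append by simp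
  qed
  then have "AE w in P. G w" unfolding G_def by (simp add: AE_all_countable)
  ultimately show ?thesis by (rule that)
qed

section \<open>Convergence of the averages in mean\<close>

lemma
  assumes "integrable P f"
  shows integrable_tail_average: "integrable P (tail_average p n f)"
    and integral_tail_average: "(\<integral>w. tail_average p n f w \<partial>P) = (\<integral>w. f w \<partial>P)"
proof -
  have "integrable P (tail_average p n f) \<and> (\<integral>w. tail_average p n f w \<partial>P) = (\<integral>w. f w \<partial>P)"
    by (induction n) (use assms in \<open>auto simp: integrable_flip_average integral_flip_average\<close>)
  then show "integrable P (tail_average p n f)"
    and "(\<integral>w. tail_average p n f w \<partial>P) = (\<integral>w. f w \<partial>P)" by auto
qed

lemma abs_tail_average_le: "\<bar>tail_average p n f w\<bar> \<le> tail_average p n (\<lambda>w. \<bar>f w\<bar>) w"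
  using tail_average_mono[where p = p, OF p flip_closed_True, where f = f and g = "\<lambda>w. \<bar>f w\<bar>" and w = w and n = n]
    tail_average_mono[where p = p, OF p flip_closed_True,
      where f = "\<lambda>w. - 1 * f w" and g = "\<lambda>w. \<bar>f w\<bar>" and w = w and n = n]
    tail_average_cmult[of p n "- 1" f w]
  by (auto simp: abs_le_iff)

lemma integral_abs_tail_average_le:
  assumes "integrable P f"
  shows "(\<integral>w. \<bar>tail_average p n f w\<bar> \<partial>P) \<le> (\<integral>w. \<bar>f w\<bar> \<partial>P)"
proof -
  have "(\<integral>w. \<bar>tail_average p n f w\<bar> \<partial>P) \<le> (\<integral>w. tail_average p n (\<lambda>w. \<bar>f w\<bar>) w \<partial>P)"
    using assms by (intro integral_mono integrable_abs integrable_tail_average abs_tail_average_le)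
  also have "\<dots> = (\<integral>w. \<bar>f w\<bar> \<partial>P)"
    using assms by (intro integral_tail_average integrable_abs)
  finally show ?thesis .
qed

text \<open>An \<open>L1\<close> form of the triviality of the tail \<sigma>-algebra, stated for one
  function so that it can be proved by induction on sets and functions.\<close>

definition tail_trivial :: "((nat \<Rightarrow> int) \<Rightarrow> real) \<Rightarrow> bool" where
  "tail_trivial f \<longleftrightarrow> (\<lambda>n. \<integral>w. \<bar>tail_average p n f w - (\<integral>w. f w \<partial>P)\<bar> \<partial>P) \<longlonglongrightarrow> 0"

lemma tail_trivial_add:
  assumes f: "integrable P f" "tail_trivial f" and g: "integrable P g" "tail_trivial g"
  shows "tail_trivial (\<lambda>w. f w + g w)"
  unfolding tail_trivial_def
proof (rule tendsto_sandwich[OF _ _ tendsto_const])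
  let ?d = "\<lambda>f n w. \<bar>tail_average p n f w - (\<integral>w. f w \<partial>P)\<bar>"
  have int: "integrable P (?d h n)" if "integrable P h" for h n
    using that by (intro integrable_abs Bochner_Integration.integrable_diff integrable_tail_average) auto
  have "(\<integral>w. ?d (\<lambda>w. f w + g w) n w \<partial>P) \<le> (\<integral>w. ?d f n w + ?d g n w \<partial>P)" for n
    using f g by (intro integral_mono int Bochner_Integration.integrable_add)
      (auto simp: tail_average_add)
  also have "(\<integral>w. ?d f n w + ?d g n w \<partial>P) = (\<integral>w. ?d f n w \<partial>P) + (\<integral>w. ?d g n w \<partial>P)" for n
    using f g by (intro Bochner_Integration.integral_add int)
  finally show "\<forall>\<^sub>F n in sequentially. (\<integral>w. ?d (\<lambda>w. f w + g w) n w \<partial>P)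
      \<le> (\<integral>w. ?d f n w \<partial>P) + (\<integral>w. ?d g n w \<partial>P)" by simp
  show "(\<lambda>n. (\<integral>w. ?d f n w \<partial>P) + (\<integral>w. ?d g n w \<partial>P)) \<longlonglongrightarrow> 0"
    using tendsto_add[OF f(2)[unfolded tail_trivial_def] g(2)[unfolded tail_trivial_def]] by simp
qed simp

lemma tail_trivial_cmult:
  assumes "tail_trivial f"
  shows "tail_trivial (\<lambda>w. c * f w)"
proof -
  have "\<bar>tail_average p n (\<lambda>w. c * f w) w - (\<integral>w. c * f w \<partial>P)\<bar>
      = \<bar>c\<bar> * \<bar>tail_average p n f w - (\<integral>w. f w \<partial>P)\<bar>" for n w
    by (simp add: tail_average_cmult abs_mult[symmetric] right_diff_distrib)
  then show ?thesis
    using tendsto_mult_left[OF assms[unfolded tail_trivial_def], of "\<bar>c\<bar>"]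
    by (simp add: tail_trivial_def)
qed

lemma tail_trivial_const: "tail_trivial (\<lambda>_. c)"
  by (simp add: tail_trivial_def prob_space)

text \<open>Once \<open>n \<ge> m\<close> the average is constant on the space, and the constant is
  its integral, hence the mean of \<open>f\<close>.\<close>

lemma tail_trivial_cylinder:
  assumes f: "integrable P f"
    and cyl: "\<And>v v'. v \<in> space P \<Longrightarrow> v' \<in> space P \<Longrightarrow> (\<forall>i<m. v i = v' i) \<Longrightarrow> f v = f v'"
  shows "tail_trivial f"
proof -
  have "(\<integral>w. \<bar>tail_average p n f w - (\<integral>w. f w \<partial>P)\<bar> \<partial>P) = 0" if n: "m \<le> n" for n
  proof -
    have const: "tail_average p n f v = tail_average p n f w" if "v \<in> space P" "w \<in> space P" for v w
      using that n by (intro tail_average_cong_cylinder[OF flip_closed_space cyl]) auto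
    have "tail_average p n f w = (\<integral>w. f w \<partial>P)" if w: "w \<in> space P" for w
    proof -
      have "(\<integral>w. f w \<partial>P) = (\<integral>v. tail_average p n f v \<partial>P)"
        by (simp add: integral_tail_average[OF f])
      also have "\<dots> = (\<integral>v. tail_average p n f w \<partial>P)"
        using w by (intro Bochner_Integration.integral_cong refl const)
      finally show ?thesis by (simp add: prob_space)
    qed
    then have "(\<integral>w. \<bar>tail_average p n f w - (\<integral>w. f w \<partial>P)\<bar> \<partial>P) = (\<integral>w. 0 \<partial>P)"
      by (intro Bochner_Integration.integral_cong) auto
    then show ?thesis by simp
  qed
  then show ?thesis
    unfolding tail_trivial_def by (intro tendsto_eventually eventually_sequentiallyI[of m])
qed

text \<open>An \<open>e / 3\<close> argument: dominated convergence makes \<open>s i\<close> close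
  to \<open>f\<close> in mean, averaging does not enlarge this distance, and it also bounds the
  difference of the two means.\<close>

lemma tail_trivial_limit:
  fixes s :: "nat \<Rightarrow> (nat \<Rightarrow> int) \<Rightarrow> real"
  assumes s: "\<And>i. integrable P (s i)" "\<And>i. tail_trivial (s i)" and "integrable P h"
    and lim: "\<And>w. w \<in> space P \<Longrightarrow> (\<lambda>i. s i w) \<longlonglongrightarrow> f w"
    and bound: "\<And>i w. w \<in> space P \<Longrightarrow> \<bar>s i w\<bar> \<le> h w" and f: "integrable P f"
  shows "tail_trivial f"
  unfolding tail_trivial_def
proof (rule LIMSEQ_I)
  let ?d = "\<lambda>f n w. \<bar>tail_average p n f w - (\<integral>w. f w \<partial>P)\<bar>"
  fix e :: real assume "0 < e"
  have "(\<lambda>i. \<integral>w. \<bar>f w - s i w\<bar> \<partial>P) \<longlonglongrightarrow> (\<integral>w. 0 \<partial>P)"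
  proof (rule integral_dominated_convergence[where w = "\<lambda>w. \<bar>f w\<bar> + h w"])
    show "AE w in P. (\<lambda>i. \<bar>f w - s i w\<bar>) \<longlonglongrightarrow> 0"
      using tendsto_diff[OF tendsto_const lim, of _ "f _"]
      by (intro AE_I2 tendsto_rabs_zero) (metis diff_self)
    show "AE w in P. norm \<bar>f w - s i w\<bar> \<le> \<bar>f w\<bar> + h w" for i
      using bound[of _ i] by (intro AE_I2) (smt (verit) real_norm_def)
  qed (use s f \<open>integrable P h\<close> in auto)
  then have "(\<lambda>i. \<integral>w. \<bar>f w - s i w\<bar> \<partial>P) \<longlonglongrightarrow> 0" by simp
  from order_tendstoD(2)[OF this, of "e / 3"] \<open>0 < e\<close>
  obtain i where i: "(\<integral>w. \<bar>f w - s i w\<bar> \<partial>P) < e / 3"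
    by (auto simp: eventually_sequentially)
  have sf: "integrable P (\<lambda>w. f w - s i w)" using s f by auto
  have int: "integrable P (?d h n)" if "integrable P h" for h n
    using that by (intro integrable_abs Bochner_Integration.integrable_diff integrable_tail_average) auto
  have "\<bar>(\<integral>w. f w \<partial>P) - (\<integral>w. s i w \<partial>P)\<bar> \<le> (\<integral>w. \<bar>f w - s i w\<bar> \<partial>P)"
    using integral_abs_bound[of P "\<lambda>w. f w - s i w"] s f by simp
  then have mean: "\<bar>(\<integral>w. f w \<partial>P) - (\<integral>w. s i w \<partial>P)\<bar> < e / 3" using i by simp
  from order_tendstoD(2)[OF s(2)[of i, unfolded tail_trivial_def], of "e / 3"] \<open>0 < e\<close>
  obtain N where N: "\<And>n. N \<le> n \<Longrightarrow> (\<integral>w. ?d (s i) n w \<partial>P) < e / 3"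
    by (auto simp: eventually_sequentially)
  have split: "?d f n w
      \<le> \<bar>tail_average p n (\<lambda>w. f w - s i w) w\<bar> + ?d (s i) n w + e / 3" for n w
    using mean unfolding tail_average_diff by linarith
  have "norm ((\<integral>w. ?d f n w \<partial>P) - 0) < e" if "N \<le> n" for n
  proof -
    have "(\<integral>w. ?d f n w \<partial>P)
        \<le> (\<integral>w. \<bar>tail_average p n (\<lambda>w. f w - s i w) w\<bar> + ?d (s i) n w + e / 3 \<partial>P)"
      using s f sf
      by (intro integral_mono int split Bochner_Integration.integrable_add integrable_abs
        integrable_tail_average) auto
    also have "\<dots> = (\<integral>w. \<bar>tail_average p n (\<lambda>w. f w - s i w) w\<bar> \<partial>P) + (\<integral>w. ?d (s i) n w \<partial>P) + e / 3"
      using s sf int[OF s(1), of i n]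
      by (simp add: integrable_tail_average prob_space)
    also have "\<dots> < e / 3 + e / 3 + e / 3"
      using integral_abs_tail_average_le[OF sf, of n] i N[OF that] by linarith
    finally show ?thesis by simp
  qed
  then show "\<exists>N. \<forall>n\<ge>N. norm ((\<integral>w. ?d f n w \<partial>P) - 0) < e" by blast
qed

text \<open>Induction from the intersection-stable algebra of cylinders over finitely many
  coordinates; countable disjoint unions are limits of finite sums of indicators.\<close>

lemma tail_trivial_indicator:
  assumes "A \<in> sets P"
  shows "tail_trivial (indicator A)"
proof -
  let ?G = "prod_algebra UNIV coin"
  have sets_P: "sets P = sigma_sets (space P) ?G"
    by (simp add: bernoulli_space_def sets_PiM space_PiM)
  have closed: "?G \<subseteq> Pow (space P)"
    using prod_algebra_sets_into_space[of UNIV coin] by (simp add: bernoulli_space_def space_PiM)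
  show ?thesis
    using Int_stable_prod_algebra closed assms[unfolded sets_P]
  proof (induction rule: sigma_sets_induct_disjoint)
    case (basic A)
    then have "A \<in> sets P" unfolding sets_P by auto
    from basic obtain J E where J: "finite J" "A = prod_emb UNIV coin J (Pi\<^sub>E J E)"
      by (elim prod_algebraE)
    then obtain m where m: "\<And>j. j \<in> J \<Longrightarrow> j < m"
      using finite_nat_set_iff_bounded by auto
    show ?case
    proof (rule tail_trivial_cylinder)
      fix v v' assume v: "v \<in> space P" "v' \<in> space P" "\<forall>i<m. v i = v' i"
      have "restrict v J = restrict v' J" using v(3) m by auto
      with v show "indicator A v = (indicator A v' :: real)"
        by (simp add: J(2) prod_emb_def bernoulli_space_def space_PiM indicator_def)
    qed (use \<open>A \<in> sets P\<close> in \<open>simp add: emeasure_eq_measure\<close>)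
  next
    case empty
    show ?case using tail_trivial_const[of 0] by (simp add: indicator_def[abs_def])
  next
    case (compl A)
    then have A: "A \<in> sets P" by (simp add: sets_P)
    have "tail_trivial (\<lambda>w. 1 + - 1 * indicator A w)"
      using A compl by (intro tail_trivial_add tail_trivial_cmult tail_trivial_const)
        (auto simp: emeasure_eq_measure)
    then have *: "tail_trivial (\<lambda>w. 1 - indicator A w)" by simp
    \<comment> \<open>\<open>1 - indicator A\<close> and the indicator of the complement agree only
      on \<open>space P\<close>; the limit lemma with a constant sequence passes from one to the
      other.\<close>
    show ?case
    proof (rule tail_trivial_limit[where s = "\<lambda>_ w. 1 - indicator A w" and h = "\<lambda>_. 1"])
      show "integrable P (indicator (space P - A) :: _ \<Rightarrow> real)"
        using A by (auto simp: emeasure_eq_measure)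
      show "integrable P (\<lambda>w. 1 - indicator A w :: real)"
        using A by (intro Bochner_Integration.integrable_diff) (auto simp: emeasure_eq_measure)
    qed (use A * in \<open>auto simp: indicator_def emeasure_eq_measure\<close>)
  next
    case (union A)
    then have A: "A i \<in> sets P" for i by (auto simp: sets_P)
    have fin: "tail_trivial (indicator (\<Union>i<m. A i))" for m :: nat
    proof (induction m)
      case 0
      show ?case using tail_trivial_const[of 0] by (simp add: indicator_def[abs_def])
    next
      case (Suc m)
      have "(\<Union>i<m. A i) \<inter> A m = {}"
        using union(1) by (auto simp: disjoint_family_on_def) (metis IntI empty_iff less_irrefl)
      then have "indicator (\<Union>i<Suc m. A i) = (\<lambda>w. indicator (\<Union>i<m. A i) w + indicator (A m) w :: real)"
        by (auto simp: lessThan_Suc indicator_def fun_eq_iff)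
      moreover have "tail_trivial (\<lambda>w. indicator (\<Union>i<m. A i) w + indicator (A m) w)"
        using A union Suc by (intro tail_trivial_add) (auto simp: emeasure_eq_measure)
      ultimately show ?case by simp
    qed
    show ?case
    proof (rule tail_trivial_limit[where s = "\<lambda>m. indicator (\<Union>i<m. A i)" and h = "\<lambda>_. 1"])
      show "(\<lambda>m. indicator (\<Union>i<m. A i) w :: real) \<longlonglongrightarrow> indicator (\<Union>i. A i) w" for w
        by (rule LIMSEQ_indicator_UN)
      show "integrable P (indicator (\<Union>i. A i) :: _ \<Rightarrow> real)"
        and "integrable P (indicator (\<Union>i<m. A i) :: _ \<Rightarrow> real)" for m :: nat
        using A by (auto simp: emeasure_eq_measure)
    qed (use A fin in \<open>auto simp: emeasure_eq_measure indicator_def\<close>)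
  qed
qed

lemma integrable_tail_trivial:
  assumes "integrable P f"
  shows "tail_trivial f"
  using assms
proof (induction rule: integrable_induct)
  case (base A c)
  then show ?case
    using tail_trivial_cmult[OF tail_trivial_indicator[OF base(1)], of c] by (simp add: mult.commute)
next
  case (add f g)
  then show ?case by (intro tail_trivial_add)
next
  case (lim f s)
  then show ?case
    by (intro tail_trivial_limit[of s "\<lambda>w. 2 * \<bar>f w\<bar>" f]) auto
qed

end

section \<open>Concentration\<close>

text \<open>For \<open>b < a\<close> the tangent bound gives a slope of at most
  \<open>exp a \<le> exp m\<close>. The estimate carries convergence in mean over to
  exponentials.\<close>

lemma exp_le_add_lipschitz:
  fixes a b m :: real
  assumes "a \<le> m"
  shows "exp a \<le> exp b + exp m * \<bar>a - b\<bar>"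
proof (cases "a \<le> b")
  case True
  then have "exp a \<le> exp b" "0 \<le> exp m * \<bar>a - b\<bar>" by simp_all
  then show ?thesis by linarith
next
  case False
  have "1 - exp (b - a) \<le> a - b"
    using exp_ge_add_one_self[of "b - a"] by linarith
  then have "exp a * (1 - exp (b - a)) \<le> exp a * (a - b)"
    by (intro mult_left_mono) auto
  also have "\<dots> \<le> exp m * (a - b)"
    using assms False by (intro mult_right_mono) auto
  finally show ?thesis
    using False by (simp add: right_diff_distrib exp_add[symmetric])
qed

text \<open>Fatou's lemma with a convergent sequence of bounds; integrability of the limit comes
  with it.\<close>

lemma integral_le_of_pointwise_limit:
  fixes u :: "nat \<Rightarrow> 'a \<Rightarrow> real"
  assumes u: "\<And>n. integrable M (u n)" "\<And>n w. 0 \<le> u n w" "\<And>n. (\<integral>w. u n w \<partial>M) \<le> c n"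
    and lim: "\<And>w. w \<in> space M \<Longrightarrow> (\<lambda>n. u n w) \<longlonglongrightarrow> f w" and c: "c \<longlonglongrightarrow> C"
  shows "integrable M f" "(\<integral>w. f w \<partial>M) \<le> C"
proof -
  have [measurable]: "f \<in> borel_measurable M"
    by (rule borel_measurable_LIMSEQ_real[where u = u]) (use u(1) lim in auto)
  have nonneg: "0 \<le> f w" if "w \<in> space M" for w
    using lim[OF that] u(2) by (intro LIMSEQ_le_const[of "\<lambda>n. u n w"]) auto
  have "0 \<le> c n" for n
    using u(2)[of n] u(3)[of n] by (meson Bochner_Integration.integral_nonneg order_trans)
  then have "0 \<le> C" using c by (intro LIMSEQ_le_const[of c]) auto
  have "(\<integral>\<^sup>+w. ennreal (f w) \<partial>M) = (\<integral>\<^sup>+w. liminf (\<lambda>n. ennreal (u n w)) \<partial>M)"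
    using lim by (intro nn_integral_cong lim_imp_Liminf[symmetric] tendsto_ennrealI) auto
  also have "\<dots> \<le> liminf (\<lambda>n. \<integral>\<^sup>+w. ennreal (u n w) \<partial>M)"
    using u(1) by (intro nn_integral_liminf) auto
  also have "\<dots> \<le> liminf (\<lambda>n. ennreal (c n))"
    using u by (intro Liminf_mono always_eventually)
      (auto simp: nn_integral_eq_integral intro!: ennreal_leI)
  also have "\<dots> = ennreal C"
    using c by (intro lim_imp_Liminf tendsto_ennrealI) auto
  finally have le: "(\<integral>\<^sup>+w. ennreal (f w) \<partial>M) \<le> ennreal C" .
  then show f: "integrable M f"
    using nonneg by (intro integrableI_nonneg) (auto intro: le_less_trans[OF le])
  from le show "(\<integral>w. f w \<partial>M) \<le> C"
    using nonneg \<open>0 \<le> C\<close> by (subst (asm) nn_integral_eq_integral[OF f]) (auto simp: ennreal_le_iff)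
qed

lemma ell2_norm_le_imp_sum_le:
  assumes "ell2_norm a \<le> ennreal N" "0 \<le> N"
  shows "(\<Sum>k<n. (a k)\<^sup>2) \<le> N\<^sup>2"
proof -
  from assms have sm: "summable (\<lambda>k. (a k)\<^sup>2)"
    by (auto simp: ell2_norm_def top_unique split: if_splits)
  then have "sqrt (\<Sum>k. (a k)\<^sup>2) \<le> N" using assms by (simp add: ell2_norm_def ennreal_le_iff)
  then have "(\<Sum>k. (a k)\<^sup>2) \<le> N\<^sup>2" by (rule sqrt_le_D)
  moreover have "(\<Sum>k<n. (a k)\<^sup>2) \<le> (\<Sum>k. (a k)\<^sup>2)" using sm by (intro sum_le_suminf) auto
  ultimately show ?thesis by simp
qed

section \<open>Exponential moments of bounded functions\<close>

context bernoulli_sequence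
begin

text \<open>\<open>V\<close> stands for the square of the gradient norm. Partial sums match the
  averages over finitely many coordinates and carry no summability condition.\<close>

definition bounded_gradient :: "real \<Rightarrow> real \<Rightarrow> ((nat \<Rightarrow> int) \<Rightarrow> real) \<Rightarrow> (nat \<Rightarrow> int) \<Rightarrow> bool" where
  "bounded_gradient K V F w \<longleftrightarrow> (\<forall>k. \<bar>F (w(k := 1)) - F (w(k := -1))\<bar> \<le> K)
    \<and> (\<forall>n. (\<Sum>k<n. (bernoulli_grad p k F w)\<^sup>2) \<le> V)"

text \<open>Serves for the negation of \<open>F\<close>, which gives the lower deviations, and for
  its truncations.\<close>

lemma bounded_gradient_contraction:
  assumes F: "bounded_gradient K V F w" and c: "\<And>a b. \<bar>c a - c b\<bar> \<le> \<bar>a - b\<bar>"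
  shows "bounded_gradient K V (\<lambda>w. c (F w)) w"
  unfolding bounded_gradient_def
proof (intro conjI allI)
  fix k
  show "\<bar>c (F (w(k := 1))) - c (F (w(k := -1)))\<bar> \<le> K"
    using F c order_trans unfolding bounded_gradient_def by blast
next
  fix n
  have "(\<Sum>k<n. (bernoulli_grad p k (\<lambda>w. c (F w)) w)\<^sup>2) \<le> (\<Sum>k<n. (bernoulli_grad p k F w)\<^sup>2)"
  proof (rule sum_mono)
    fix k
    have "(c (F (w(k := 1))) - c (F (w(k := -1))))\<^sup>2 \<le> (F (w(k := 1)) - F (w(k := -1)))\<^sup>2"
      using c by (simp add: abs_le_square_iff)
    then show "(bernoulli_grad p k (\<lambda>w. c (F w)) w)\<^sup>2 \<le> (bernoulli_grad p k F w)\<^sup>2"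
      unfolding bernoulli_grad_def power_mult_distrib by (intro mult_left_mono) auto
  qed
  also have "\<dots> \<le> V" using F by (simp add: bounded_gradient_def)
  finally show "(\<Sum>k<n. (bernoulli_grad p k (\<lambda>w. c (F w)) w)\<^sup>2) \<le> V" .
qed

text \<open>For \<open>K > 0\<close> and \<open>V \<ge> 0\<close>, the Laplace transform at
  \<open>t\<close> of \<open>K * (Z - V / K\<^sup>2)\<close>, where \<open>Z\<close> is Poisson with
  mean \<open>V / K\<^sup>2\<close>.\<close>

definition laplace_factor :: "real \<Rightarrow> real \<Rightarrow> real \<Rightarrow> real" where
  "laplace_factor K V t = exp (V / K\<^sup>2 * (exp (t * K) - 1 - t * K))"

text \<open>The bound for averages over \<open>n\<close> coordinates is integrated, and
  \<open>n\<close> tends to infinity. Boundedness by \<open>M\<close> makes the exponential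
  Lipschitz on the range, so convergence of the averages in mean is enough.\<close>

lemma laplace_bounded:
  assumes F[measurable]: "F \<in> borel_measurable P" and M: "\<And>w. \<bar>F w\<bar> \<le> M"
    and grad: "AE w in P. bounded_gradient K V F w" and "0 < K" "0 \<le> t"
  shows "integrable P (\<lambda>w. exp (t * F w))"
    and "(\<integral>w. exp (t * F w) \<partial>P) \<le> laplace_factor K V t * exp (t * (\<integral>w. F w \<partial>P))"
proof -
  define C where "C = laplace_factor K V t"
  define E where "E = (\<integral>w. F w \<partial>P)"
  define d where "d n = (\<integral>w. \<bar>tail_average p n F w - E\<bar> \<partial>P)" for n
  have "0 < C" by (simp add: C_def laplace_factor_def)
  have intF: "integrable P F"
    using M by (intro integrable_const_bound[of _ M]) auto
  have tM: "t * F w \<le> t * M" for w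
    using M[of w] \<open>0 \<le> t\<close> by (intro mult_left_mono) auto
  show int: "integrable P (\<lambda>w. exp (t * F w))"
    using tM by (intro integrable_const_bound[of _ "exp (t * M)"]) auto
  \<comment> \<open>The average at \<open>w\<close> involves flips of \<open>w\<close>, about which
    a bound at \<open>w\<close> alone says nothing; hence the passage to a flip-closed set of full
    measure.\<close>
  obtain G where G: "flip_closed G" "\<And>w. G w \<Longrightarrow> bounded_gradient K V F w" "AE w in P. G w"
    using AE_flip_closed[OF grad] by blast
  have "d \<longlonglongrightarrow> 0"
    using integrable_tail_trivial[OF intF] by (simp add: tail_trivial_def d_def[abs_def] E_def)
  have intT: "integrable P (\<lambda>w. \<bar>tail_average p n F w - E\<bar>)" for n
    by (intro integrable_abs Bochner_Integration.integrable_diff integrable_tail_average intF) simp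
  have "(\<integral>w. exp (t * F w) \<partial>P) \<le> C * (exp (t * E) + exp (t * M) * (t * d n))" for n
  proof -
    have "AE w in P. tail_average p n (\<lambda>w. exp (t * F w)) w
        \<le> C * (exp (t * E) + exp (t * M) * (t * \<bar>tail_average p n F w - E\<bar>))"
      using G(3)
    proof eventually_elim
      case (elim w)
      have "tail_average p n (\<lambda>w. exp (t * F w)) w \<le> C * exp (t * tail_average p n F w)"
        unfolding C_def laplace_factor_def
        using G(2) by (intro tail_average_exp_le[OF p \<open>0 < K\<close> \<open>0 \<le> t\<close> G(1) elim])
          (auto simp: bounded_gradient_def)
      also have "tail_average p n F w \<le> tail_average p n (\<lambda>_. M) w"
        using M by (intro tail_average_mono[OF p flip_closed_True]) (auto simp: abs_le_iff)
      then have "t * tail_average p n F w \<le> t * M"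
        using \<open>0 \<le> t\<close> by (intro mult_left_mono) auto
      from exp_le_add_lipschitz[OF this, of "t * E"]
      have "exp (t * tail_average p n F w)
          \<le> exp (t * E) + exp (t * M) * (t * \<bar>tail_average p n F w - E\<bar>)"
        using \<open>0 \<le> t\<close> by (simp add: right_diff_distrib[symmetric] abs_mult)
      finally show ?case using \<open>0 < C\<close> by simp
    qed
    then have "(\<integral>w. tail_average p n (\<lambda>w. exp (t * F w)) w \<partial>P)
        \<le> (\<integral>w. C * (exp (t * E) + exp (t * M) * (t * \<bar>tail_average p n F w - E\<bar>)) \<partial>P)"
      using intT by (intro integral_mono_AE integrable_tail_average int) auto
    also have "\<dots> = C * (exp (t * E) + exp (t * M) * (t * d n))"
      using intT by (simp add: d_def prob_space)
    finally show ?thesis by (simp add: integral_tail_average[OF int])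
  qed
  moreover have "(\<lambda>n. C * (exp (t * E) + exp (t * M) * (t * d n)))
      \<longlonglongrightarrow> C * (exp (t * E) + exp (t * M) * (t * 0))"
    by (intro tendsto_intros \<open>d \<longlonglongrightarrow> 0\<close>)
  ultimately have "(\<integral>w. exp (t * F w) \<partial>P) \<le> C * (exp (t * E) + exp (t * M) * (t * 0))"
    by (intro LIMSEQ_le_const) auto
  then show "(\<integral>w. exp (t * F w) \<partial>P) \<le> laplace_factor K V t * exp (t * (\<integral>w. F w \<partial>P))"
    by (simp add: C_def E_def)
qed

text \<open>Combines \<open>\<bar>y\<bar> \<le> exp y + exp (- y)\<close> with the exponential
  bounds for \<open>F\<close> and \<open>- F\<close> at \<open>t = 1\<close>. The result is free of
  \<open>M\<close>, hence uniform over truncations.\<close>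

lemma mean_deviation_bounded:
  assumes F[measurable]: "F \<in> borel_measurable P" and M: "\<And>w. \<bar>F w\<bar> \<le> M"
    and grad: "AE w in P. bounded_gradient K V F w" and "0 < K"
  shows "(\<integral>w. \<bar>F w - (\<integral>w. F w \<partial>P)\<bar> \<partial>P) \<le> 2 * laplace_factor K V 1"
proof -
  define E where "E = (\<integral>w. F w \<partial>P)"
  have intF: "integrable P F"
    using M by (intro integrable_const_bound[of _ M]) auto
  have "AE w in P. bounded_gradient K V (\<lambda>w. - F w) w"
    using grad by eventually_elim (rule bounded_gradient_contraction, auto)
  note neg = laplace_bounded[of "\<lambda>w. - F w" M K V 1, OF _ _ this]
  note pos = laplace_bounded[of F M K V 1, OF _ _ grad]
  have le: "\<bar>y\<bar> \<le> exp y + exp (- y)" for y :: real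
    using exp_ge_add_one_self[of y] exp_ge_add_one_self[of "- y"] exp_gt_zero[of y] exp_gt_zero[of "- y"]
    by linarith
  have "(\<integral>w. \<bar>F w - E\<bar> \<partial>P) \<le> (\<integral>w. exp (- E) * exp (1 * F w) + exp E * exp (1 * (- F w)) \<partial>P)"
  proof (rule integral_mono)
    show "integrable P (\<lambda>w. exp (- E) * exp (1 * F w) + exp E * exp (1 * (- F w)))"
      using pos(1) neg(1) M \<open>0 < K\<close> by (intro Bochner_Integration.integrable_add) auto
    show "\<bar>F w - E\<bar> \<le> exp (- E) * exp (1 * F w) + exp E * exp (1 * (- F w))" for w
      using le[of "F w - E"] by (simp add: exp_add[symmetric])
  qed (use intF in auto)
  also have "\<dots> = exp (- E) * (\<integral>w. exp (1 * F w) \<partial>P) + exp E * (\<integral>w. exp (1 * (- F w)) \<partial>P)"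
    using pos neg M \<open>0 < K\<close> by (subst Bochner_Integration.integral_add) auto
  also have "\<dots> \<le> exp (- E) * (laplace_factor K V 1 * exp (1 * E))
      + exp E * (laplace_factor K V 1 * exp (1 * (- E)))"
    using pos(2) neg(2) M \<open>0 < K\<close> by (intro add_mono mult_left_mono) (auto simp: E_def)
  also have "\<dots> = 2 * laplace_factor K V 1"
    by (simp add: exp_minus)
  finally show ?thesis by (simp add: E_def)
qed

lemma integral_abs_bounded:
  assumes F[measurable]: "F \<in> borel_measurable P" and M: "\<And>w. \<bar>F w\<bar> \<le> M"
    and grad: "AE w in P. bounded_gradient K V F w" and "0 < K"
    and A: "A \<in> sets P" "1 / 2 \<le> prob A" "\<And>w. w \<in> A \<Longrightarrow> \<bar>F w\<bar> \<le> R" and "0 \<le> R"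
  shows "(\<integral>w. \<bar>F w\<bar> \<partial>P) \<le> 2 * R + 6 * laplace_factor K V 1"
proof -
  define E where "E = (\<integral>w. F w \<partial>P)"
  have intF: "integrable P F"
    using M by (intro integrable_const_bound[of _ M]) auto
  have dev: "(\<integral>w. \<bar>F w - E\<bar> \<partial>P) \<le> 2 * laplace_factor K V 1"
    unfolding E_def by (rule mean_deviation_bounded[OF F M grad \<open>0 < K\<close>])
  \<comment> \<open>On \<open>A\<close> the mean is within \<open>R + \<bar>F w - E\<bar>\<close> of
    \<open>0\<close>; integrating over a set of mass at least one half then bounds
    \<open>\<bar>E\<bar>\<close> independently of \<open>M\<close>.\<close>
  have ptw: "\<bar>E\<bar> * indicator A w \<le> R + \<bar>F w - E\<bar>" for w
    using A(3)[of w] \<open>0 \<le> R\<close> by (auto simp: indicator_def)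
  have "\<bar>E\<bar> * (1 / 2) \<le> \<bar>E\<bar> * prob A"
    using A(2) by (intro mult_left_mono) auto
  also have "\<dots> = (\<integral>w. \<bar>E\<bar> * indicator A w \<partial>P)"
    using A(1) by simp
  also have "\<dots> \<le> (\<integral>w. R + \<bar>F w - E\<bar> \<partial>P)"
    using ptw intF A(1) by (intro integral_mono) (auto simp: emeasure_eq_measure)
  also have "\<dots> = R + (\<integral>w. \<bar>F w - E\<bar> \<partial>P)"
    using intF by (simp add: prob_space)
  finally have E: "\<bar>E\<bar> \<le> 2 * R + 4 * laplace_factor K V 1" using dev by simp
  have "(\<integral>w. \<bar>F w\<bar> \<partial>P) \<le> (\<integral>w. \<bar>F w - E\<bar> + \<bar>E\<bar> \<partial>P)"
    using intF by (intro integral_mono) auto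
  also have "\<dots> = (\<integral>w. \<bar>F w - E\<bar> \<partial>P) + \<bar>E\<bar>"
    using intF by (simp add: prob_space)
  finally show ?thesis using dev E by simp
qed

section \<open>Removal of boundedness\<close>

lemma ex_half_mass_bound:
  assumes F[measurable]: "F \<in> borel_measurable P"
  obtains R :: real where "0 \<le> R" "1 / 2 \<le> prob {w \<in> space P. \<bar>F w\<bar> \<le> R}"
proof -
  let ?A = "\<lambda>n::nat. {w \<in> space P. \<bar>F w\<bar> \<le> real n}"
  have "(\<lambda>n. prob (?A n)) \<longlonglongrightarrow> prob (\<Union>n. ?A n)"
    by (intro finite_Lim_measure_incseq) (auto simp: incseq_def)
  also have "(\<Union>n. ?A n) = space P" using real_arch_simple by auto
  finally have "(\<lambda>n. prob (?A n)) \<longlonglongrightarrow> 1" by (simp add: prob_space)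
  from order_tendstoD(1)[OF this, of "1 / 2"]
  obtain n where "1 / 2 < prob (?A n)" by (auto simp: eventually_sequentially)
  then show ?thesis by (intro that[of "real n"]) auto
qed

text \<open>One set of mass at least one half with \<open>\<bar>F\<bar> \<le> R\<close> serves all
  truncations \<open>H n\<close>, so their absolute means are uniformly bounded and Fatou gives
  integrability. Then the means of \<open>H n\<close> converge, and Fatou applies again to the
  exponentials.\<close>

lemma
  assumes F[measurable]: "F \<in> borel_measurable P"
    and grad: "AE w in P. bounded_gradient K V F w" and "0 < K"
  shows integrable_of_bounded_gradient: "integrable P F"
    and integrable_exp_of_bounded_gradient: "0 \<le> t \<Longrightarrow> integrable P (\<lambda>w. exp (t * F w))"
    and laplace_le: "0 \<le> t \<Longrightarrow>
      (\<integral>w. exp (t * F w) \<partial>P) \<le> laplace_factor K V t * exp (t * (\<integral>w. F w \<partial>P))"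
proof -
  define H where "H n w = max (- real n) (min (real n) (F w))" for n w
  have H[measurable]: "H n \<in> borel_measurable P" for n unfolding H_def by measurable
  have H_le: "\<bar>H n w\<bar> \<le> real n" for n w by (auto simp: H_def)
  have H_abs: "\<bar>H n w\<bar> \<le> \<bar>F w\<bar>" for n w by (auto simp: H_def)
  have H_grad: "AE w in P. bounded_gradient K V (H n) w" for n
    using grad unfolding H_def by eventually_elim (rule bounded_gradient_contraction, auto)
  have H_lim: "(\<lambda>n. H n w) \<longlonglongrightarrow> F w" for w
  proof (rule tendsto_eventually, rule eventually_sequentiallyI)
    fix n assume "nat \<lceil>\<bar>F w\<bar>\<rceil> \<le> n"
    then have "\<bar>F w\<bar> \<le> real n" by linarith
    then show "H n w = F w" by (auto simp: H_def)
  qed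
  have H_int: "integrable P (H n)" for n
    using H_le by (intro integrable_const_bound[of _ "real n"]) auto
  obtain R where R: "0 \<le> R" "1 / 2 \<le> prob {w \<in> space P. \<bar>F w\<bar> \<le> R}"
    using ex_half_mass_bound[OF F] by blast
  have "integrable P (\<lambda>w. \<bar>F w\<bar>)"
  proof (rule integral_le_of_pointwise_limit(1)[where u = "\<lambda>n w. \<bar>H n w\<bar>"])
    show "(\<integral>w. \<bar>H n w\<bar> \<partial>P) \<le> 2 * R + 6 * laplace_factor K V 1" for n
      by (rule integral_abs_bounded[OF H H_le H_grad \<open>0 < K\<close> _ R(2) _ R(1)])
        (use H_abs in \<open>auto intro: order_trans[OF H_abs]\<close>)
  qed (use H_int H_lim in \<open>auto intro!: tendsto_rabs\<close>)
  then show intF: "integrable P F" by (rule integrable_abs_cancel) simp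
  have mean: "(\<lambda>n. \<integral>w. H n w \<partial>P) \<longlonglongrightarrow> (\<integral>w. F w \<partial>P)"
    by (rule integral_dominated_convergence[where w = "\<lambda>w. \<bar>F w\<bar>"])
      (use H_lim H_abs intF in auto)
  assume t: "0 \<le> t"
  note bounded = laplace_bounded[OF H H_le H_grad \<open>0 < K\<close> t]
  note limit = integral_le_of_pointwise_limit[where M = P and u = "\<lambda>n w. exp (t * H n w)"
      and f = "\<lambda>w. exp (t * F w)" and c = "\<lambda>n. laplace_factor K V t * exp (t * (\<integral>w. H n w \<partial>P))"
      and C = "laplace_factor K V t * exp (t * (\<integral>w. F w \<partial>P))", OF bounded(1) _ bounded(2)]
  show "integrable P (\<lambda>w. exp (t * F w))"
    by (rule limit(1)) (auto intro!: tendsto_intros H_lim mean)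
  show "(\<integral>w. exp (t * F w) \<partial>P) \<le> laplace_factor K V t * exp (t * (\<integral>w. F w \<partial>P))"
    by (rule limit(2)) (auto intro!: tendsto_intros H_lim mean)
qed

section \<open>Deviation bounds\<close>

lemma chernoff:
  assumes F[measurable]: "F \<in> borel_measurable P"
    and grad: "AE w in P. bounded_gradient K V F w" and "0 < K" and t: "0 \<le> t"
  shows "prob {w \<in> space P. x \<le> F w - (\<integral>w. F w \<partial>P)} \<le> laplace_factor K V t * exp (- (t * x))"
\<comment> \<open>For \<open>t = 0\<close> the right-hand side is \<open>1\<close>; rewriting the
  event through the exponential requires \<open>t > 0\<close>.\<close>
proof (cases "t = 0")
  case True
  then show ?thesis by (simp add: laplace_factor_def)
next
  case False
  with t have "0 < t" by simp
  define E where "E = (\<integral>w. F w \<partial>P)"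
  have "{w \<in> space P. x \<le> F w - E} = {w \<in> space P. exp (t * (E + x)) \<le> exp (t * F w)}"
    using \<open>0 < t\<close> by (simp add: mult_le_cancel_left_pos le_diff_eq add.commute)
  also have "prob \<dots> \<le> (\<integral>w. exp (t * F w) \<partial>P) / exp (t * (E + x))"
    using integrable_exp_of_bounded_gradient[OF F grad \<open>0 < K\<close> t]
    by (intro integral_Markov_inequality_measure[of _ _ "{}"]) auto
  also have "\<dots> \<le> laplace_factor K V t * exp (t * E) / exp (t * (E + x))"
    using laplace_le[OF F grad \<open>0 < K\<close> t] by (intro divide_right_mono) (auto simp: E_def)
  also have "\<dots> = laplace_factor K V t * exp (- (t * x))"
    by (simp add: distrib_left exp_add exp_minus field_simps)
  finally show ?thesis by (simp add: E_def)
qed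

text \<open>With \<open>V = 0\<close> the Laplace factor is \<open>1\<close> for every
  \<open>t\<close>, so letting \<open>t\<close> run through the naturals drives Chernoff's bound to
  \<open>0\<close>.\<close>

lemma deviation_degenerate:
  assumes F: "F \<in> borel_measurable P"
    and grad: "AE w in P. bounded_gradient K 0 F w" and "0 < K" and x: "0 < x"
  shows "prob {w \<in> space P. x \<le> F w - (\<integral>w. F w \<partial>P)} \<le> 0"
proof (rule LIMSEQ_le_const)
  show "(\<lambda>n. exp (- x) ^ n) \<longlonglongrightarrow> 0"
    using x by (intro LIMSEQ_power_zero) simp
  have "prob {w \<in> space P. x \<le> F w - (\<integral>w. F w \<partial>P)} \<le> exp (- x) ^ n" for n
    using chernoff[OF F grad \<open>0 < K\<close>, of "real n" x]
    by (simp add: laplace_factor_def exp_of_nat_mult[symmetric])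
  then show "\<exists>N. \<forall>n\<ge>N. prob {w \<in> space P. x \<le> F w - (\<integral>w. F w \<partial>P)} \<le> exp (- x) ^ n"
    by blast
qed

lemma deviation_bennett:
  assumes F: "F \<in> borel_measurable P"
    and grad: "AE w in P. bounded_gradient K (N\<^sup>2) F w" and "0 < K" "N \<noteq> 0" and x: "0 \<le> x"
  shows "prob {w \<in> space P. x \<le> F w - (\<integral>w. F w \<partial>P)} \<le> bennett_bound N K x"
proof -
  define u where "u = x * K / N\<^sup>2"
  \<comment> \<open>This minimizes
    \<open>N\<^sup>2 / K\<^sup>2 * (exp (t * K) - 1 - t * K) - t * x\<close>, whose derivative
    vanishes when \<open>exp (t * K) = 1 + u\<close>.\<close>
  define t where "t = ln (1 + u) / K"
  have "0 \<le> u" using assms by (simp add: u_def)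
  then have "0 \<le> t" using \<open>0 < K\<close> by (simp add: t_def)
  have x_eq: "x = u * N\<^sup>2 / K" using assms by (simp add: u_def)
  have "exp (t * K) = 1 + u" using \<open>0 < K\<close> \<open>0 \<le> u\<close> by (simp add: t_def)
  then have "laplace_factor K (N\<^sup>2) t * exp (- (t * x))
      = exp (N\<^sup>2 / K\<^sup>2 * (u - ln (1 + u)) - ln (1 + u) / K * (u * N\<^sup>2 / K))"
    using \<open>0 < K\<close> by (simp add: laplace_factor_def exp_add[symmetric] t_def x_eq[symmetric])
  also have "N\<^sup>2 / K\<^sup>2 * (u - ln (1 + u)) - ln (1 + u) / K * (u * N\<^sup>2 / K)
      = - (N\<^sup>2 / K\<^sup>2) * bennett_g u"
    using \<open>0 < K\<close> by (simp add: bennett_g_def field_simps power2_eq_square)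
  also have "exp \<dots> = bennett_bound N K x"
    using assms by (simp add: bennett_bound_def u_def)
  finally show ?thesis using chernoff[OF F grad \<open>0 < K\<close> \<open>0 \<le> t\<close>, of x] by simp
qed

lemma AE_bounded_gradient:
  assumes diff: "\<And>k. AE w in P. \<bar>F (w(k := 1)) - F (w(k := -1))\<bar> \<le> K"
    and DF: "grad_Linf_norm p F < \<infinity>"
  shows "AE w in P. bounded_gradient K ((enn2real (grad_Linf_norm p F))\<^sup>2) F w"
proof -
  \<comment> \<open>Finiteness matters here, since \<open>enn2real\<close> sends an infinite norm to
    \<open>0\<close>.\<close>
  have fin: "ennreal (enn2real (grad_Linf_norm p F)) = grad_Linf_norm p F"
    using DF by simp
  have "AE w in P. ell2_norm (\<lambda>k. bernoulli_grad p k F w) \<le> ennreal (enn2real (grad_Linf_norm p F))"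
    unfolding fin unfolding grad_Linf_norm_def by (rule esssup_AE)
  moreover have "AE w in P. \<forall>k. \<bar>F (w(k := 1)) - F (w(k := -1))\<bar> \<le> K"
    using diff by (simp add: AE_all_countable)
  ultimately show ?thesis
    by eventually_elim (auto simp: bounded_gradient_def intro: ell2_norm_le_imp_sum_le)
qed

text \<open>If \<open>K = 0\<close> all increments vanish, and if \<open>N = 0\<close> all partial
  sums do, so \<open>V = 0\<close> either way. The bound \<open>K + 1\<close> stays positive at
  \<open>K = 0\<close>, as the exponential estimates require.\<close>

lemma AE_bounded_gradient_degenerate:
  assumes grad: "AE w in P. bounded_gradient K (N\<^sup>2) F w" and "K = 0 \<or> N = 0"
  shows "AE w in P. bounded_gradient (K + 1) 0 F w"
  using grad
proof eventually_elim
  case (elim w)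
  have "\<bar>F (w(k := 1)) - F (w(k := -1))\<bar> \<le> K + 1" for k
    using elim by (auto simp: bounded_gradient_def intro: order_trans)
  moreover have "(\<Sum>k<n. (bernoulli_grad p k F w)\<^sup>2) \<le> 0" for n
    using elim assms(2) by (auto simp: bounded_gradient_def bernoulli_grad_def)
  ultimately show ?case by (simp add: bounded_gradient_def)
qed

end

text \<open>Integrability belongs to the conclusion because the Bochner integral of a non-integrable
  \<open>F\<close> is \<open>0\<close> by convention and could not serve as the mean.\<close>

theorem proposition12p1:
  fixes p :: "nat \<Rightarrow> real" and F :: "(nat \<Rightarrow> int) \<Rightarrow> real" and K :: real
  assumes p: "\<And>k. 0 < p k \<and> p k < 1"
    and F: "F \<in> borel_measurable (bernoulli_space p)"
    and K: "0 \<le> K"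
    and F_diff: "\<And>k. AE w in bernoulli_space p. \<bar>F (w(k := 1)) - F (w(k := -1))\<bar> \<le> K"
    and DF: "grad_Linf_norm p F < \<infinity>"
  shows "integrable (bernoulli_space p) F \<and>
    (\<forall>x\<ge>0.
      measure (bernoulli_space p)
        {w \<in> space (bernoulli_space p). F w - integral\<^sup>L (bernoulli_space p) F \<ge> x}
        \<le> bennett_bound (enn2real (grad_Linf_norm p F)) K x \<and>
      bennett_bound (enn2real (grad_Linf_norm p F)) K x
        \<le> log_bound (enn2real (grad_Linf_norm p F)) K x)"
proof -
  interpret bernoulli_sequence p by standard (rule p)
  define N where "N = enn2real (grad_Linf_norm p F)"
  have grad: "AE w in P. bounded_gradient K (N\<^sup>2) F w"
    unfolding N_def by (rule AE_bounded_gradient[OF F_diff DF])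
  have "integrable P F \<and> prob {w \<in> space P. x \<le> F w - (\<integral>w. F w \<partial>P)} \<le> bennett_bound N K x"
    if x: "0 \<le> x" for x
  proof (cases "K = 0 \<or> N = 0")
    case True
    note deg = AE_bounded_gradient_degenerate[OF grad True]
    have "0 < K + 1" using K by simp
    with integrable_of_bounded_gradient[OF F deg] deviation_degenerate[OF F deg, of x] True x
    show ?thesis by (auto simp: bennett_bound_def)
  next
    case False
    with K have "0 < K" "N \<noteq> 0" by auto
    with integrable_of_bounded_gradient[OF F grad] deviation_bennett[OF F grad _ _ x]
    show ?thesis by simp
  qed
  note * = this[unfolded N_def]
  \<comment> \<open>The instance at \<open>x = 0\<close> supplies the integrability, which does not
    involve \<open>x\<close>.\<close>
  show ?thesis
    using *[of 0] * bennett_bound_le_log_bound[OF K] by blast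
qed

end
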